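(* There exists a strongly connected oriented graph $D$ with maximum degree $\Delta(D)\le 5$ such that $\mathrm{fas}(D)> 2n/3$, where $n$ is the number of vertices of $D$. (That is, the conjecture that $\mathrm{fas}(D)\le 2n/3$ for every strongly connected oriented graph $D$ with $\Delta(D)\le 5$ is false.)
   Context: All digraphs are finite. An oriented graph is a directed graph without loops, without parallel arcs and without directed cycles of length 2. The degree of a vertex is the sum of its out-degree and in-degree, and $\Delta(D)$ is the maximum degree. $\mathrm{fas}(D)$ is the minimum number of arcs in a feedback arc set of $D$, i.e. in a set $F$ of arcs such that $D-F$ has no directed cycle. *)

theory Defs
  imports Complex_Main "Graph_Theory.Graph_Theory"
begin

text \<open>The library locale \<open>digraph\<close> already requires finiteness, no loops and no parallel arcs.\<close>

locale oriented_graph = digraph +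
  assumes no_2_cycles: "u \<rightarrow>\<^bsub>G\<^esub> v \<Longrightarrow> \<not> v \<rightarrow>\<^bsub>G\<^esub> u"

definition degree :: "('a, 'b) pre_digraph \<Rightarrow> 'a \<Rightarrow> nat" where
  "degree G v = out_degree G v + in_degree G v"

text \<open>Meaningful for finite digraphs with at least one vertex.\<close>

definition max_degree :: "('a, 'b) pre_digraph \<Rightarrow> nat" where
  "max_degree G = Max (degree G ` verts G)"

definition del_arcs :: "('a, 'b) pre_digraph \<Rightarrow> 'b set \<Rightarrow> ('a, 'b) pre_digraph" where
  "del_arcs G F = G\<lparr>arcs := arcs G - F\<rparr>"

definition feedback_arc_set :: "('a, 'b) pre_digraph \<Rightarrow> 'b set \<Rightarrow> bool" where
  "feedback_arc_set G F \<longleftrightarrow>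
     F \<subseteq> arcs G \<and> \<not> (\<exists>p. pre_digraph.cycle (del_arcs G F) p)"

text \<open>For a finite digraph this minimum ranges over a finite set, which is nonempty because
  the set of all arcs is a feedback arc set.\<close>

definition fas :: "('a, 'b) pre_digraph \<Rightarrow> nat" where
  "fas G = Min (card ` {F. feedback_arc_set G F})"

lemma (in fin_digraph) fas_attained: "\<exists>F. feedback_arc_set G F \<and> card F = fas G"
proof -
  have "{F. feedback_arc_set G F} \<subseteq> Pow (arcs G)"
    by (auto simp: feedback_arc_set_def)
  then have fin: "finite {F. feedback_arc_set G F}"
    by (rule finite_subset) simp
  have "feedback_arc_set G (arcs G)"
    by (auto simp: feedback_arc_set_def del_arcs_def pre_digraph.cycle_def pre_digraph.awalk_def)
  then have "card ` {F. feedback_arc_set G F} \<noteq> {}"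
    by blast
  with fin have "fas G \<in> card ` {F. feedback_arc_set G F}"
    unfolding fas_def by (intro Min_in) auto
  then show ?thesis
    by auto
qed

end

theory Submission
  imports Defs
begin

text \<open>The witness has 7 vertices and 17 arcs. Nine of its directed cycles (the triangle
  0, 1, 3 counted twice, six further triangles and one 4-cycle) use no arc more than twice
  altogether. A feedback arc set meets each of them, so it has at least 9/2, hence at least 5
  arcs, and 5 exceeds 14/3.\<close>

definition witness_arcs :: "(nat \<times> nat) list" where
  "witness_arcs = [(0,1), (0,5), (1,2), (1,3), (2,0), (2,3), (2,6), (3,0), (3,4),
    (4,2), (4,5), (5,1), (5,3), (5,6), (6,0), (6,1), (6,4)]"

text \<open>An arc is the pair of its ends, so parallel arcs cannot occur. The arcs come from a list
  so that simplification can enumerate and filter them.\<close>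

definition witness :: "(nat, nat \<times> nat) pre_digraph" where
  "witness = \<lparr>verts = {..<7}, arcs = set witness_arcs, tail = fst, head = snd\<rparr>"

lemma witness_simps [simp]:
  "verts witness = {..<7}" "arcs witness = set witness_arcs"
  "tail witness = fst" "head witness = snd"
  by (simp_all add: witness_def)

lemma oriented_graph_witness: "oriented_graph witness"
  by unfold_locales
    (auto simp: witness_arcs_def arc_to_ends_def arcs_ends_def)

text \<open>A cycle of \<open>G\<close> that avoids \<open>F\<close> would survive in
  \<open>del_arcs G F\<close>, which is acyclic.\<close>

lemma feedback_arc_set_meets_cycle:
  assumes "feedback_arc_set G F" "pre_digraph.cycle G p"
  shows "set p \<inter> F \<noteq> {}"
proof
  assume "set p \<inter> F = {}"
  \<comment> \<open>Both functions read only \<open>tail\<close> and \<open>head\<close>, which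
    deleting arcs leaves unchanged; the deletion affects a walk only through the membership of its
    arcs.\<close>
  moreover have "pre_digraph.awalk_verts (del_arcs G F) u q = pre_digraph.awalk_verts G u q"
    and "pre_digraph.cas (del_arcs G F) u q v = pre_digraph.cas G u q v" for u v q
    by (induction q arbitrary: u)
      (simp_all add: pre_digraph.awalk_verts.simps pre_digraph.cas.simps del_arcs_def)
  ultimately have "pre_digraph.cycle (del_arcs G F) p"
    using assms(2)
    by (auto simp: pre_digraph.cycle_def pre_digraph.awalk_def del_arcs_def)
  with assms(1) show False
    by (auto simp: feedback_arc_set_def)
qed

lemma strongly_connected_witness: "strongly_connected witness"
proof -
  interpret oriented_graph witness
    by (rule oriented_graph_witness)
  have step: "u \<rightarrow>\<^sup>*\<^bsub>witness\<^esub> v" if "(u, v) \<in> set witness_arcs" for u v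
    using that by (intro reachable_adjI) (force simp: arcs_ends_def arc_to_ends_def)
  \<comment> \<open>These arcs form a Hamiltonian cycle. Vertex 0 then serves as a hub: any
    \<open>u\<close> reaches any \<open>v\<close> through it.\<close>
  have arcs: "0 \<rightarrow>\<^sup>*\<^bsub>witness\<^esub> 1" "1 \<rightarrow>\<^sup>*\<^bsub>witness\<^esub> 2" "2 \<rightarrow>\<^sup>*\<^bsub>witness\<^esub> 3" "3 \<rightarrow>\<^sup>*\<^bsub>witness\<^esub> 4" "4 \<rightarrow>\<^sup>*\<^bsub>witness\<^esub> 5" "5 \<rightarrow>\<^sup>*\<^bsub>witness\<^esub> 6"
    "6 \<rightarrow>\<^sup>*\<^bsub>witness\<^esub> 0"
    by (rule step, simp add: witness_arcs_def)+
  have from_0: "0 \<rightarrow>\<^sup>*\<^bsub>witness\<^esub> 2" "0 \<rightarrow>\<^sup>*\<^bsub>witness\<^esub> 3" "0 \<rightarrow>\<^sup>*\<^bsub>witness\<^esub> 4" "0 \<rightarrow>\<^sup>*\<^bsub>witness\<^esub> 5" "0 \<rightarrow>\<^sup>*\<^bsub>witness\<^esub> 6" "0 \<rightarrow>\<^sup>*\<^bsub>witness\<^esub> 0"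
    using arcs by (meson reachable_trans)+
  have to_0: "5 \<rightarrow>\<^sup>*\<^bsub>witness\<^esub> 0" "4 \<rightarrow>\<^sup>*\<^bsub>witness\<^esub> 0" "3 \<rightarrow>\<^sup>*\<^bsub>witness\<^esub> 0" "2 \<rightarrow>\<^sup>*\<^bsub>witness\<^esub> 0" "1 \<rightarrow>\<^sup>*\<^bsub>witness\<^esub> 0"
    using arcs by (meson reachable_trans)+
  have via_0: "0 \<rightarrow>\<^sup>*\<^bsub>witness\<^esub> v \<and> v \<rightarrow>\<^sup>*\<^bsub>witness\<^esub> 0" if "v < 7" for v
  proof -
    have "v \<in> {0, 1, 2, 3, 4, 5, 6}"
      using that by auto
    then show ?thesis
      using arcs(1,7) from_0 to_0 by fast
  qed
  show ?thesis
  proof (rule strongly_connectedI)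
    show "u \<rightarrow>\<^sup>*\<^bsub>witness\<^esub> v" if "u \<in> verts witness" "v \<in> verts witness" for u v
      using that via_0 reachable_trans by (metis lessThan_iff witness_simps(1))
  qed (simp add: lessThan_empty_iff)
qed

lemma max_degree_witness: "max_degree witness \<le> 5"
proof -
  have "degree witness v \<le> 5" if "v < 7" for v
  proof -
    have mem: "v \<in> {0, 1, 2, 3, 4, 5, 6}"
      using that by auto
    \<comment> \<open>A set has at most as many elements as a list that represents it, so list
      lengths, computable for each vertex, bound the degree. They give 4 at vertex 4 and 5
      elsewhere.\<close>
    have "out_arcs witness v = set (filter (\<lambda>e. fst e = v) witness_arcs)"
      "in_arcs witness v = set (filter (\<lambda>e. snd e = v) witness_arcs)"
      by (auto simp: out_arcs_def in_arcs_def)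
    then have "degree witness v \<le>
        length (filter (\<lambda>e. fst e = v) witness_arcs) +
        length (filter (\<lambda>e. snd e = v) witness_arcs)"
      unfolding degree_def out_degree_def in_degree_def by (simp only: add_mono card_length)
    also from mem have "\<dots> \<le> 5"
      by (elim insertE) (simp_all add: witness_arcs_def)
    finally show ?thesis .
  qed
  then show ?thesis
    by (auto simp: max_degree_def lessThan_empty_iff)
qed

lemma feedback_arc_set_witness_card:
  assumes "feedback_arc_set witness F"
  shows "card F \<ge> 5"
proof -
  \<comment> \<open>With this 0/1 indicator of \<open>F\<close>, meeting a given cycle becomes a
    linear inequality.\<close>
  define x :: "nat \<Rightarrow> nat \<Rightarrow> nat" where "x u v = of_bool ((u, v) \<in> F)" for u v
  have hit: "set p \<inter> F \<noteq> {}" if "pre_digraph.cycle witness p" for p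
    using feedback_arc_set_meets_cycle assms that .
  note cycle_simps = pre_digraph.cycle_def pre_digraph.awalk_def pre_digraph.cas.simps
    pre_digraph.awalk_verts.simps witness_arcs_def
  have "x 0 1 + x 1 3 + x 3 0 \<ge> 1"
    using hit[of "[(0,1), (1,3), (3,0)]"] by (auto simp: cycle_simps x_def)
  moreover have "x 0 5 + x 5 6 + x 6 0 \<ge> 1"
    using hit[of "[(0,5), (5,6), (6,0)]"] by (auto simp: cycle_simps x_def)
  moreover have "x 1 2 + x 2 6 + x 6 1 \<ge> 1"
    using hit[of "[(1,2), (2,6), (6,1)]"] by (auto simp: cycle_simps x_def)
  moreover have "x 3 4 + x 4 5 + x 5 3 \<ge> 1"
    using hit[of "[(3,4), (4,5), (5,3)]"] by (auto simp: cycle_simps x_def)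
  moreover have "x 3 4 + x 4 2 + x 2 3 \<ge> 1"
    using hit[of "[(3,4), (4,2), (2,3)]"] by (auto simp: cycle_simps x_def)
  moreover have "x 6 4 + x 4 5 + x 5 6 \<ge> 1"
    using hit[of "[(6,4), (4,5), (5,6)]"] by (auto simp: cycle_simps x_def)
  moreover have "x 6 4 + x 4 2 + x 2 6 \<ge> 1"
    using hit[of "[(6,4), (4,2), (2,6)]"] by (auto simp: cycle_simps x_def)
  moreover have "x 0 5 + x 5 1 + x 1 2 + x 2 0 \<ge> 1"
    using hit[of "[(0,5), (5,1), (1,2), (2,0)]"] by (auto simp: cycle_simps x_def)
  \<comment> \<open>This puts \<open>card F\<close> in the same variables as the cycle
    inequalities.\<close>
  moreover have "card F = (\<Sum>(u, v)\<in>set witness_arcs. x u v)"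
  proof -
    have "F \<subseteq> set witness_arcs"
      using assms by (auto simp: feedback_arc_set_def)
    then have "card F = card (set witness_arcs \<inter> F)"
      by (simp add: Int_absorb1)
    also have "\<dots> = (\<Sum>e\<in>set witness_arcs. of_bool (e \<in> F))"
      by (simp add: witness_arcs_def Int_def)
    finally show ?thesis
      by (simp add: x_def case_prod_unfold)
  qed
  \<comment> \<open>Twice the first inequality plus the other seven has every coefficient at most 2,
    so 9 \<le> 2 * \<open>card F\<close>; \<open>card F\<close> \<le> 4 would give 9 \<le>
    8.\<close>
  ultimately show ?thesis
    by (simp add: witness_arcs_def)
qed

theorem corollary10:
  shows "\<exists>D :: (nat, nat \<times> nat) pre_digraph.
    oriented_graph D \<and> strongly_connected D \<and> max_degree D \<le> 5 \<and>
    real (fas D) > 2 * real (card (verts D)) / 3"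
proof -
  interpret oriented_graph witness
    by (rule oriented_graph_witness)
  \<comment> \<open>The minimum is attained by some feedback arc set, to which the bound 5
    applies.\<close>
  have "fas witness \<ge> 5"
    using fas_attained feedback_arc_set_witness_card by metis
  then have "real (fas witness) > 2 * real (card (verts witness)) / 3"
    by simp
  then show ?thesis
    using oriented_graph_witness strongly_connected_witness max_degree_witness by blast
qed

end
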